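(* Let $n_1\ge 2$ and $n_2\ge 2$ be integers, let $e$ be an edge of the complete bipartite graph $K_{n_1,n_2}$ with parts $V_{n_1}$ and $V_{n_2}$ of sizes $n_1$ and $n_2$, and let $e_1$ be an edge joining the endpoint of $e$ in $V_{n_1}$ to another vertex of $V_{n_1}$. Then $$a(K_{n_1,n_2})>a(K_{n_1,n_2}+e_1-e).$$
   Context: An acyclic orientation of a graph $G$ is an assignment of a direction to each edge of $G$ such that the resulting directed graph has no directed cycles; $a(G)$ denotes the number of acyclic orientations of $G$. For a graph $G$, $G-e$ denotes $G$ with the edge $e$ deleted and $G+e_1$ denotes $G$ with the new edge $e_1$ added (same vertex set). *)

theory Defs
  imports Main
begin

text \<open>Undirected simple graphs: an edge is the two-element set of its endpoints.\<close>

record 'a ugraph =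
  verts :: "'a set"
  edges :: "'a set set"

definition add_edge :: "'a ugraph \<Rightarrow> 'a set \<Rightarrow> 'a ugraph" where
  "add_edge G e = G\<lparr>edges := insert e (edges G)\<rparr>"

definition delete_edge :: "'a ugraph \<Rightarrow> 'a set \<Rightarrow> 'a ugraph" where
  "delete_edge G e = G\<lparr>edges := edges G - {e}\<rparr>"

definition complete_bipartite :: "'a set \<Rightarrow> 'a set \<Rightarrow> 'a ugraph" where
  "complete_bipartite A B = \<lparr>verts = A \<union> B, edges = {{x, y} | x y. x \<in> A \<and> y \<in> B}\<rparr>"

text \<open>
  An orientation is given by its set of arcs, the pair \<open>(x, y)\<close> being the edge \<open>{x, y}\<close>
  directed from \<open>x\<close> to \<open>y\<close>. Bijectivity of the map that forgets directions says that every
  edge receives exactly one direction and that there are no other arcs.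
\<close>

definition orientation :: "'a ugraph \<Rightarrow> ('a \<times> 'a) set \<Rightarrow> bool" where
  "orientation G D \<longleftrightarrow> bij_betw (\<lambda>(x, y). {x, y}) D (edges G)"

definition acyclic_orientations :: "'a ugraph \<Rightarrow> ('a \<times> 'a) set set" where
  "acyclic_orientations G = {D. orientation G D \<and> acyclic D}"

definition num_acyclic_orientations :: "'a ugraph \<Rightarrow> nat" where
  "num_acyclic_orientations G = card (acyclic_orientations G)"

text \<open>For finite graphs the cardinality above is a genuine count.\<close>

lemma finite_acyclic_orientations:
  assumes "finite (verts G)" and "\<And>e. e \<in> edges G \<Longrightarrow> e \<subseteq> verts G"
  shows "finite (acyclic_orientations G)"
proof -
  have "acyclic_orientations G \<subseteq> Pow (verts G \<times> verts G)"
  proof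
    fix D assume "D \<in> acyclic_orientations G"
    then have *: "(\<lambda>(x, y). {x, y}) ` D = edges G"
      by (auto simp: acyclic_orientations_def orientation_def bij_betw_def)
    have "x \<in> verts G \<and> y \<in> verts G" if "(x, y) \<in> D" for x y
    proof -
      from that have "{x, y} \<in> edges G" unfolding *[symmetric] by force
      then show ?thesis using assms(2) by blast
    qed
    then show "D \<in> Pow (verts G \<times> verts G)" by auto
  qed
  then show ?thesis using assms(1) by (meson finite_Pow_iff finite_SigmaI finite_subset)
qed

end

theory Submission
  imports Defs
begin

text \<open>
  Let \<open>H\<close> be \<open>K - e\<close> for the complete bipartite graph \<open>K\<close>, and let \<open>e = uv\<close>. Both graphs of the
  theorem arise from \<open>H\<close> by adding one edge at \<open>u\<close>: the edge \<open>uv\<close> gives \<open>K\<close>, the edge \<open>uw\<close> gives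
  \<open>K + e\<^sub>1 - e\<close>. An acyclic orientation of \<open>H\<close> extends to a new edge \<open>xy\<close> in one way if a directed
  path joins \<open>x\<close> and \<open>y\<close>, and in two ways if none does. So adding \<open>xy\<close> increases the count by the
  number of acyclic orientations of \<open>H\<close> in which \<open>x\<close> and \<open>y\<close> are incomparable
  (\<open>num_acyclic_orientations_add_edge\<close>), and the pair \<open>u, v\<close> has to be incomparable
  more often than the pair \<open>u, w\<close>.

  By deletion and contraction the two numbers of incomparabilities are the numbers of acyclic
  orientations of \<open>H/uv\<close> and of \<open>H/uw\<close>, of which a lower and an upper bound suffice.
  Every neighbour of \<open>u\<close> is a neighbour of \<open>w\<close>, so that \<open>H/uw\<close> is \<open>H - u\<close>, and an orientation with
  \<open>u\<close> and \<open>w\<close> incomparable is determined by what it does on \<open>H - u\<close>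
  (\<open>card_incomparable_dominated_le\<close>). An acyclic orientation of \<open>H/uv\<close> pulls back to one of \<open>H\<close> in
  which \<open>u\<close> and \<open>v\<close> are incomparable (\<open>card_incomparable_ge_quotient\<close>). Finally \<open>H/uv\<close> contains
  \<open>H - u\<close> and has further edges, from the merged vertex to the neighbours of \<open>u\<close>, which lie on the
  same side as \<open>v\<close>. Each further edge strictly increases the number of acyclic orientations
  (\<open>num_acyclic_orientations_mono_strong\<close>).
\<close>

section \<open>Acyclic orientations of simple graphs\<close>

definition simple_graph :: "'a ugraph \<Rightarrow> bool" where
  "simple_graph G \<longleftrightarrow> finite (verts G) \<and> (\<forall>e \<in> edges G. e \<subseteq> verts G \<and> card e = 2)"

definition incomparable_orientations :: "'a ugraph \<Rightarrow> 'a \<Rightarrow> 'a \<Rightarrow> ('a \<times> 'a) set set" where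
  "incomparable_orientations G x y =
    {D \<in> acyclic_orientations G. (x, y) \<notin> D\<^sup>* \<and> (y, x) \<notin> D\<^sup>*}"

definition delete_vertex :: "'a ugraph \<Rightarrow> 'a \<Rightarrow> 'a ugraph" where
  "delete_vertex G x = \<lparr>verts = verts G - {x}, edges = {e \<in> edges G. x \<notin> e}\<rparr>"

lemma simple_graph_edge:
  assumes "simple_graph G" "{x, y} \<in> edges G"
  shows "x \<noteq> y" "x \<in> verts G" "y \<in> verts G"
  using assms by (force simp: simple_graph_def)+

lemma simple_graph_edgeE:
  assumes "simple_graph G" "e \<in> edges G"
  obtains x y where "e = {x, y}" "x \<noteq> y"
  using assms by (auto simp: simple_graph_def card_2_iff)

lemma simple_graph_add_edge:
  assumes "simple_graph G" "x \<in> verts G" "y \<in> verts G" "x \<noteq> y"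
  shows "simple_graph (add_edge G {x, y})"
  using assms by (auto simp: simple_graph_def add_edge_def)

lemma simple_graph_delete_vertex:
  "simple_graph G \<Longrightarrow> simple_graph (delete_vertex G x)"
  by (auto simp: simple_graph_def delete_vertex_def)

lemma finite_acyclic_orientations_simple:
  "simple_graph G \<Longrightarrow> finite (acyclic_orientations G)"
  by (rule finite_acyclic_orientations) (auto simp: simple_graph_def)

lemma finite_incomparable_orientations:
  "simple_graph G \<Longrightarrow> finite (incomparable_orientations G x y)"
  by (simp add: incomparable_orientations_def finite_acyclic_orientations_simple)

lemma acyclic_not_sym:
  assumes "acyclic D" "(x, y) \<in> D"
  shows "(y, x) \<notin> D"
  using assms by (meson acyclic_def r_into_trancl' trancl_trans)

text \<open>
  Once a set of arcs is acyclic, no edge can carry both directions, so the injectivity demanded of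
  an orientation reduces to the arcs lying on edges and covering them.
\<close>

lemma acyclic_orientations_iff:
  assumes "simple_graph G"
  shows "D \<in> acyclic_orientations G \<longleftrightarrow>
    acyclic D \<and> (\<forall>x y. (x, y) \<in> D \<longrightarrow> {x, y} \<in> edges G) \<and>
    (\<forall>x y. {x, y} \<in> edges G \<longrightarrow> (x, y) \<in> D \<or> (y, x) \<in> D)"
    (is "_ \<longleftrightarrow> ?R")
proof
  assume D: "D \<in> acyclic_orientations G"
  then have ac: "acyclic D" and im: "(\<lambda>(x, y). {x, y}) ` D = edges G"
    by (auto simp: acyclic_orientations_def orientation_def bij_betw_def)
  have "(x, y) \<in> D \<or> (y, x) \<in> D" if "{x, y} \<in> edges G" for x y
    using that unfolding im[symmetric] by (auto simp: doubleton_eq_iff)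
  moreover have "{x, y} \<in> edges G" if "(x, y) \<in> D" for x y
    using that unfolding im[symmetric] by force
  ultimately show ?R using ac by blast
next
  assume R: ?R
  have "inj_on (\<lambda>(x, y). {x, y}) D"
    using R acyclic_not_sym by (fastforce simp: inj_on_def doubleton_eq_iff)
  moreover have "(\<lambda>(x, y). {x, y}) ` D = edges G"
  proof
    show "(\<lambda>(x, y). {x, y}) ` D \<subseteq> edges G" using R by auto
    show "edges G \<subseteq> (\<lambda>(x, y). {x, y}) ` D"
    proof
      fix e assume e: "e \<in> edges G"
      then obtain x y where xy: "e = {x, y}"
        using assms by (auto elim: simple_graph_edgeE)
      then have "(x, y) \<in> D \<or> (y, x) \<in> D" using R e by blast
      then show "e \<in> (\<lambda>(x, y). {x, y}) ` D"
        using xy by (auto simp: image_iff doubleton_eq_iff)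
    qed
  qed
  ultimately show "D \<in> acyclic_orientations G"
    using R by (simp add: acyclic_orientations_def orientation_def bij_betw_def)
qed

lemma acyclic_orientationsI:
  assumes "simple_graph G" "acyclic D"
    and "\<And>x y. (x, y) \<in> D \<Longrightarrow> {x, y} \<in> edges G"
    and "\<And>x y. {x, y} \<in> edges G \<Longrightarrow> (x, y) \<in> D \<or> (y, x) \<in> D"
  shows "D \<in> acyclic_orientations G"
  using assms by (simp add: acyclic_orientations_iff)

lemma acyclic_orientationsD:
  assumes "simple_graph G" "D \<in> acyclic_orientations G"
  shows "acyclic D"
    and "(x, y) \<in> D \<Longrightarrow> {x, y} \<in> edges G"
    and "{x, y} \<in> edges G \<Longrightarrow> (x, y) \<in> D \<or> (y, x) \<in> D"
  using assms by (auto simp: acyclic_orientations_iff)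

lemma edges_add_edge [simp]: "edges (add_edge G e) = insert e (edges G)"
  by (simp add: add_edge_def)

section \<open>Adding an edge\<close>

text \<open>
  The two directions of the new edge split the acyclic orientations of the larger graph into
  two classes, each determined by the restriction to the smaller graph.
\<close>

lemma acyclic_orientations_add_edge:
  assumes G: "simple_graph G" and xy: "x \<in> verts G" "y \<in> verts G" "x \<noteq> y"
    and new: "{x, y} \<notin> edges G"
  shows "acyclic_orientations (add_edge G {x, y}) =
    insert (x, y) ` {D \<in> acyclic_orientations G. (y, x) \<notin> D\<^sup>*} \<union>
    insert (y, x) ` {D \<in> acyclic_orientations G. (x, y) \<notin> D\<^sup>*}" (is "?L = ?A \<union> ?B")
proof
  have G': "simple_graph (add_edge G {x, y})"
    using G xy by (rule simple_graph_add_edge)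
  have split: "\<exists>D' \<in> acyclic_orientations G. (q, p) \<notin> D'\<^sup>* \<and> D = insert (p, q) D'"
    if D: "D \<in> ?L" and pq: "(p, q) \<in> D" "{p, q} = {x, y}" for D p q
  proof -
    note D' = acyclic_orientationsD[OF G' D]
    let ?D = "D - {(p, q)}"
    have ins: "D = insert (p, q) ?D" using pq by blast
    then have "acyclic (insert (p, q) ?D)" using D'(1) by (rule subst)
    then have "acyclic ?D \<and> (q, p) \<notin> ?D\<^sup>*" by (rule acyclic_insert[THEN iffD1])
    then have ac: "acyclic ?D" "(q, p) \<notin> ?D\<^sup>*" by blast+
    have "?D \<in> acyclic_orientations G"
    proof (rule acyclic_orientationsI[OF G ac(1)])
      fix a b assume ab: "(a, b) \<in> ?D"
      have "(q, p) \<notin> D" using acyclic_not_sym[OF D'(1) pq(1)] .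
      then have "{a, b} \<noteq> {x, y}"
        using ab unfolding pq(2)[symmetric] by (auto simp: doubleton_eq_iff)
      then show "{a, b} \<in> edges G" using D'(2)[of a b] ab by auto
    next
      fix a b assume ab: "{a, b} \<in> edges G"
      then have "{a, b} \<noteq> {p, q}" using new pq(2) by auto
      then show "(a, b) \<in> ?D \<or> (b, a) \<in> ?D" using D'(3)[of a b] ab by auto
    qed
    then show ?thesis using ac ins by blast
  qed
  show "?L \<subseteq> ?A \<union> ?B"
  proof
    fix D assume D: "D \<in> ?L"
    have "(x, y) \<in> D \<or> (y, x) \<in> D"
      using acyclic_orientationsD(3)[OF G' D] by simp
    then show "D \<in> ?A \<union> ?B"
      using split[OF D, of x y] split[OF D, of y x] by (auto simp: insert_commute)
  qed
  have join: "insert (p, q) D \<in> ?L"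
    if D: "D \<in> acyclic_orientations G" and pq: "(q, p) \<notin> D\<^sup>*" "{p, q} = {x, y}" for D p q
  proof (rule acyclic_orientationsI[OF G'])
    show "acyclic (insert (p, q) D)"
      using pq acyclic_orientationsD(1)[OF G D] by (simp add: acyclic_insert)
  next
    fix a b assume "(a, b) \<in> insert (p, q) D"
    then show "{a, b} \<in> edges (add_edge G {x, y})"
      using pq acyclic_orientationsD(2)[OF G D] by auto
  next
    fix a b assume "{a, b} \<in> edges (add_edge G {x, y})"
    then have "{a, b} = {p, q} \<or> {a, b} \<in> edges G" using pq by simp
    then show "(a, b) \<in> insert (p, q) D \<or> (b, a) \<in> insert (p, q) D"
      using acyclic_orientationsD(3)[OF G D] by (auto simp: doubleton_eq_iff)
  qed
  show "?A \<union> ?B \<subseteq> ?L"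
    using join by (auto simp: insert_commute)
qed

text \<open>
  Since an acyclic orientation has no directed paths both from \<open>x\<close> to \<open>y\<close> and back, it extends in at
  least one direction, and in both exactly when \<open>x\<close> and \<open>y\<close> are incomparable.
\<close>

lemma num_acyclic_orientations_add_edge:
  assumes G: "simple_graph G" and xy: "x \<in> verts G" "y \<in> verts G" "x \<noteq> y"
    and new: "{x, y} \<notin> edges G"
  shows "num_acyclic_orientations (add_edge G {x, y}) =
    num_acyclic_orientations G + card (incomparable_orientations G x y)"
proof -
  let ?A = "{D \<in> acyclic_orientations G. (y, x) \<notin> D\<^sup>*}"
  let ?B = "{D \<in> acyclic_orientations G. (x, y) \<notin> D\<^sup>*}"
  have fin: "finite ?A" "finite ?B" using finite_acyclic_orientations_simple[OF G] by auto
  have arcs: "(x, y) \<notin> D" "(y, x) \<notin> D" if "D \<in> acyclic_orientations G" for D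
    using acyclic_orientationsD(2)[OF G that] new by (metis insert_commute)+
  have inj: "inj_on (insert (x, y)) ?A" "inj_on (insert (y, x)) ?B"
    by (auto simp: inj_on_def insert_ident arcs)
  have disj: "insert (x, y) ` ?A \<inter> insert (y, x) ` ?B = {}"
    using arcs xy by auto
  have un: "?A \<union> ?B = acyclic_orientations G"
    using acyclic_orientationsD(1)[OF G] xy(3)
    by (auto dest!: acyclic_impl_antisym_rtrancl dest: antisymD)
  have int: "?A \<inter> ?B = incomparable_orientations G x y"
    by (auto simp: incomparable_orientations_def)
  have "num_acyclic_orientations (add_edge G {x, y}) = card ?A + card ?B"
    unfolding num_acyclic_orientations_def acyclic_orientations_add_edge[OF G xy new]
    using fin disj by (simp add: card_Un_disjoint card_image inj)
  also have "\<dots> = card (?A \<union> ?B) + card (?A \<inter> ?B)" by (rule card_Un_Int[OF fin])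
  finally show ?thesis by (simp add: un int num_acyclic_orientations_def)
qed

text \<open>
  This makes the increase caused by a new edge strict.
  Orienting every edge upwards along a labelling of the vertices that is injective except that
  \<open>x\<close> and \<open>y\<close> share a label leaves \<open>x\<close> and \<open>y\<close> incomparable.
\<close>

lemma incomparable_orientations_nonempty:
  assumes G: "simple_graph G" and new: "{x, y} \<notin> edges G" and xy: "x \<noteq> y"
  shows "incomparable_orientations G x y \<noteq> {}"
proof -
  have "finite (verts G)" using G by (simp add: simple_graph_def)
  then obtain h :: "'a \<Rightarrow> nat" where h: "inj_on h (verts G)"
    using finite_imp_inj_to_nat_seg by blast
  define f where "f v = (if v \<in> {x, y} then 0 else Suc (h v))" for v
  define D where "D = {(p, q). {p, q} \<in> edges G \<and> f p < f q}"
  have up: "f p < f q" if "(p, q) \<in> D\<^sup>+" for p q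
    using that by (induction rule: trancl_induct) (auto simp: D_def)
  have ac: "acyclic D" using up by (fastforce simp: acyclic_def)
  have "D \<in> acyclic_orientations G"
  proof (rule acyclic_orientationsI[OF G ac])
    fix a b assume ab: "{a, b} \<in> edges G"
    have "f a \<noteq> f b"
      using simple_graph_edge[OF G ab] ab new h
      by (auto simp: f_def inj_on_def insert_commute)
    then show "(a, b) \<in> D \<or> (b, a) \<in> D" using ab by (auto simp: D_def insert_commute)
  qed (simp add: D_def)
  moreover have "(x, y) \<notin> D\<^sup>*" "(y, x) \<notin> D\<^sup>*"
    using up xy by (fastforce simp: rtrancl_eq_or_trancl f_def)+
  ultimately show ?thesis by (auto simp: incomparable_orientations_def)
qed

text \<open>
  Each new edge adds at least one acyclic orientation, so the edges can be put in one at a time.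
  Counting the new edges gives the weak and the strict monotonicity together.
\<close>

lemma num_acyclic_orientations_mono_strong:
  assumes G: "simple_graph G" and G': "simple_graph G'"
    and V: "verts G = verts G'" and E: "edges G \<subseteq> edges G'"
  shows "num_acyclic_orientations G + card (edges G' - edges G) \<le> num_acyclic_orientations G'"
proof -
  let ?with = "\<lambda>F. G\<lparr>edges := edges G \<union> F\<rparr>"
  have "num_acyclic_orientations G + card F \<le> num_acyclic_orientations (?with F)"
    if "finite F" "F \<subseteq> edges G' - edges G" for F
    using that
  proof (induction F rule: finite_induct)
    case empty
    then show ?case by simp
  next
    case (insert e F)
    obtain x y where e: "e = {x, y}" "x \<noteq> y"
      using simple_graph_edgeE[OF G', of e] insert.prems by auto
    have xy: "x \<in> verts (?with F)" "y \<in> verts (?with F)"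
      using simple_graph_edge[OF G', of x y] insert.prems e V by auto
    have F: "simple_graph (?with F)"
      using G G' V insert.prems by (auto simp: simple_graph_def)
    have new: "{x, y} \<notin> edges (?with F)" using insert e by auto
    have "card (incomparable_orientations (?with F) x y) > 0"
      using incomparable_orientations_nonempty[OF F new e(2)]
        finite_incomparable_orientations[OF F] by (simp add: card_gt_0_iff)
    moreover have "?with (insert e F) = add_edge (?with F) {x, y}"
      using e by (simp add: add_edge_def)
    ultimately show ?case
      using num_acyclic_orientations_add_edge[OF F xy e(2) new] insert by simp
  qed
  moreover have "finite (edges G')"
    using G' finite_subset[of "edges G'" "Pow (verts G')"] by (auto simp: simple_graph_def)
  moreover have "?with (edges G' - edges G) = G'" using V E by (simp add: Un_absorb1)
  ultimately show ?thesis by (metis finite_Diff order_refl)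
qed

section \<open>Incomparability and identification of vertices\<close>

text \<open>
  A map that identifies \<open>x\<close> and \<open>y\<close> turns a directed path between them into a closed walk.
  Hence an acyclic orientation of the quotient pulls back to one of \<open>G\<close> that keeps \<open>x\<close> and \<open>y\<close>
  incomparable. It can be recovered from its pullback because every edge of the quotient
  comes from an edge of \<open>G\<close>.
\<close>

lemma card_incomparable_ge_quotient:
  assumes G: "simple_graph G" and Q: "simple_graph Q"
    and edges: "edges Q = (`) g ` edges G" and gxy: "g x = g y" and xy: "x \<noteq> y"
  shows "num_acyclic_orientations Q \<le> card (incomparable_orientations G x y)"
proof -
  define pull where "pull D = {(p, q). {p, q} \<in> edges G \<and> (g p, g q) \<in> D}" for D
  have walk: "(g p, g q) \<in> D\<^sup>+" if "(p, q) \<in> (pull D)\<^sup>+" for p q D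
    using that by (induction rule: trancl_induct) (auto simp: pull_def intro: trancl_into_trancl)
  \<comment> \<open>An arc of \<open>Q\<close> lifts to an arc of the pullback, which remembers its direction.\<close>
  have "inj_on pull (acyclic_orientations Q)"
  proof -
    have "D \<subseteq> D'"
      if D: "D \<in> acyclic_orientations Q" and eq: "pull D = pull D'" for D D'
    proof
      fix z assume z: "z \<in> D"
      obtain a b where ab: "z = (a, b)" by fastforce
      then have "{a, b} \<in> edges Q" using acyclic_orientationsD(2)[OF Q D] z by simp
      then obtain p q where pq: "{p, q} \<in> edges G" "{a, b} = {g p, g q}"
        unfolding edges using simple_graph_edgeE[OF G]
        by (metis (no_types, opaque_lifting) image_empty image_iff image_insert)
      then consider "a = g p" "b = g q" | "a = g q" "b = g p"
        by (auto simp: doubleton_eq_iff)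
      then show "z \<in> D'"
      proof cases
        case 1
        then have "(p, q) \<in> pull D" using pq z ab by (simp add: pull_def)
        then show ?thesis using 1 ab unfolding eq by (simp add: pull_def)
      next
        case 2
        then have "(q, p) \<in> pull D" using pq z ab by (simp add: pull_def insert_commute)
        then show ?thesis using 2 ab unfolding eq by (simp add: pull_def)
      qed
    qed
    then show ?thesis by (metis inj_onI subset_antisym)
  qed
  moreover have "pull D \<in> incomparable_orientations G x y"
    if D: "D \<in> acyclic_orientations Q" for D
  proof -
    note D' = acyclic_orientationsD[OF Q D]
    have closed: "(p, q) \<notin> (pull D)\<^sup>+" if "g p = g q" for p q
      using walk D'(1) that by (metis acyclic_def)
    have "pull D \<in> acyclic_orientations G"
    proof (rule acyclic_orientationsI[OF G])
      show "acyclic (pull D)" using closed by (simp add: acyclic_def)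
    next
      fix a b assume ab: "{a, b} \<in> edges G"
      then have "g ` {a, b} \<in> edges Q" unfolding edges by (rule imageI)
      then have "(g a, g b) \<in> D \<or> (g b, g a) \<in> D" using D'(3) by simp
      then show "(a, b) \<in> pull D \<or> (b, a) \<in> pull D"
        using ab by (auto simp: pull_def insert_commute)
    qed (simp add: pull_def)
    then show ?thesis
      using closed gxy xy by (simp add: incomparable_orientations_def rtrancl_eq_or_trancl)
  qed
  ultimately show ?thesis
    unfolding num_acyclic_orientations_def
    using finite_incomparable_orientations[OF G]
    by (meson card_inj_on_le image_subsetI)
qed

text \<open>
  If \<open>q\<close> is adjacent to both of two incomparable vertices \<open>x\<close> and \<open>y\<close>, its edges to them point the
  same way, for otherwise they form a path through \<open>q\<close>. So the arcs at \<open>x\<close> can be read off from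
  those at \<open>y\<close>.
\<close>

lemma card_incomparable_dominated_le:
  assumes G: "simple_graph G" and xy: "x \<noteq> y"
    and dom: "\<And>q. {x, q} \<in> edges G \<Longrightarrow> {y, q} \<in> edges G"
  shows "card (incomparable_orientations G x y) \<le> num_acyclic_orientations (delete_vertex G x)"
proof -
  let ?I = "incomparable_orientations G x y"
  define res where "res D = {(p, q) \<in> D. p \<noteq> x \<and> q \<noteq> x}" for D :: "('a \<times> 'a) set"
  have res_sub: "res D \<subseteq> D" for D by (auto simp: res_def)
  have Gx: "simple_graph (delete_vertex G x)" using G by (rule simple_graph_delete_vertex)
  have orient: "D \<in> acyclic_orientations G" if "D \<in> ?I" for D
    using that by (simp add: incomparable_orientations_def)
  have "res D \<in> acyclic_orientations (delete_vertex G x)" if "D \<in> ?I" for D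
  proof -
    note D' = acyclic_orientationsD[OF G orient[OF that]]
    show ?thesis
    proof (rule acyclic_orientationsI[OF Gx])
      show "acyclic (res D)" using acyclic_subset[OF D'(1) res_sub] .
    qed (use D'(2,3) in \<open>auto simp: delete_vertex_def res_def\<close>)
  qed
  moreover have "inj_on res ?I"
  proof -
    have twins: "(x, q) \<in> D \<longleftrightarrow> (y, q) \<in> D" "(q, x) \<in> D \<longleftrightarrow> (q, y) \<in> D"
      if D: "D \<in> ?I" and q: "{x, q} \<in> edges G" for D q
    proof -
      note D' = acyclic_orientationsD[OF G orient[OF D]]
      have path: "\<not> ((x, q) \<in> D \<and> (q, y) \<in> D)" "\<not> ((y, q) \<in> D \<and> (q, x) \<in> D)"
        using D unfolding incomparable_orientations_def
        by (auto dest: r_into_rtrancl rtrancl_trans)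
      have cover: "(x, q) \<in> D \<or> (q, x) \<in> D" "(y, q) \<in> D \<or> (q, y) \<in> D"
        using D'(3) q dom[OF q] by blast+
      have once: "\<not> ((x, q) \<in> D \<and> (q, x) \<in> D)" "\<not> ((y, q) \<in> D \<and> (q, y) \<in> D)"
        using acyclic_not_sym[OF D'(1)] by blast+
      show "(x, q) \<in> D \<longleftrightarrow> (y, q) \<in> D" "(q, x) \<in> D \<longleftrightarrow> (q, y) \<in> D"
        using path cover once by blast+
    qed
    have "D \<subseteq> D'" if D: "D \<in> ?I" "D' \<in> ?I" and eq: "res D = res D'" for D D'
    proof
      fix z assume z: "z \<in> D"
      obtain p q where pq: "z = (p, q)" by fastforce
      have away: "(a, b) \<in> D \<longleftrightarrow> (a, b) \<in> D'" if "a \<noteq> x" "b \<noteq> x" for a b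
        using eq that by (auto simp: res_def set_eq_iff)
      have edge: "{p, q} \<in> edges G"
        using acyclic_orientationsD(2)[OF G orient[OF D(1)]] z pq by simp
      then have ne: "p \<noteq> q" by (rule simple_graph_edge[OF G])
      consider "p = x" | "q = x" | "p \<noteq> x" "q \<noteq> x" by blast
      then show "z \<in> D'"
      proof cases
        case 1
        then show ?thesis
          using twins(1)[OF D(1)] twins(1)[OF D(2)] away[of y q] edge ne z pq xy by auto
      next
        case 2
        then have "{x, p} \<in> edges G" using edge by (simp add: insert_commute)
        then show ?thesis
          using 2 twins(2)[OF D(1)] twins(2)[OF D(2)] away[of p y] ne z pq xy by auto
      next
        case 3
        then show ?thesis using away z pq by simp
      qed
    qed
    then show ?thesis by (metis inj_onI subset_antisym)
  qed
  ultimately show ?thesis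
    unfolding num_acyclic_orientations_def
    using finite_acyclic_orientations_simple[OF Gx]
    by (meson card_inj_on_le image_subsetI)
qed

text \<open>
  Both sums of the edge-adding formula start with the orientations of \<open>G\<close>; the comparison is
  between the incomparable pairs, that is, between two contractions.
  In \<open>G\<close>, the vertex \<open>w\<close> dominates \<open>u\<close>, so merging \<open>u\<close> into \<open>w\<close> creates nothing beyond \<open>G - u\<close>,
  whereas merging \<open>u\<close> into \<open>v\<close> creates at least the edge \<open>vb\<close>.
\<close>

lemma num_acyclic_orientations_add_dominated_less:
  assumes G: "simple_graph G"
    and V: "u \<in> verts G" "v \<in> verts G" "w \<in> verts G" and ne: "u \<noteq> v" "u \<noteq> w"
    and new: "{u, v} \<notin> edges G" "{u, w} \<notin> edges G"
    and dom: "\<And>q. {u, q} \<in> edges G \<Longrightarrow> {w, q} \<in> edges G"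
    and b: "{u, b} \<in> edges G" "{v, b} \<notin> edges G"
  shows "num_acyclic_orientations (add_edge G {u, w}) < num_acyclic_orientations (add_edge G {u, v})"
proof -
  define g where "g = id(u := v)"
  \<comment> \<open>The graph \<open>G/uv\<close>, with the merged vertex called \<open>v\<close>.\<close>
  define Q where "Q = \<lparr>verts = verts G - {u}, edges = (`) g ` edges G\<rparr>"
  have g: "g u = v" "\<And>p. p \<noteq> u \<Longrightarrow> g p = p" by (auto simp: g_def)
  have Gu: "simple_graph (delete_vertex G u)" using G by (rule simple_graph_delete_vertex)
  have Q: "simple_graph Q"
    unfolding simple_graph_def
  proof (intro conjI ballI)
    show "finite (verts Q)" using G by (simp add: Q_def simple_graph_def)
  next
    fix e assume "e \<in> edges Q"
    then obtain p q where pq: "{p, q} \<in> edges G" "e = {g p, g q}"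
      unfolding Q_def using simple_graph_edgeE[OF G]
      by (auto, metis image_empty image_insert)
    have "g p \<noteq> g q"
      using simple_graph_edge(1)[OF G pq(1)] pq(1) new(1)
      by (auto simp: g_def insert_commute split: if_splits)
    then show "card e = 2" using pq by simp
    show "e \<subseteq> verts Q"
      using simple_graph_edge[OF G pq(1)] pq(2) V(2) ne(1) by (auto simp: Q_def g_def)
  qed
  have "edges (delete_vertex G u) \<subseteq> edges Q"
  proof
    fix e assume e: "e \<in> edges (delete_vertex G u)"
    then have "e \<in> edges G" "u \<notin> e" by (simp_all add: delete_vertex_def)
    moreover from \<open>u \<notin> e\<close> have "g ` e = e" by (auto simp: g_def)
    ultimately show "e \<in> edges Q" using imageI[of e "edges G" "(`) g"] by (simp add: Q_def)
  qed
  moreover have "{v, b} \<in> edges Q - edges (delete_vertex G u)"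
  proof -
    have "g ` {u, b} = {v, b}" using g simple_graph_edge[OF G b(1)] by auto
    then have "{v, b} \<in> edges Q" using imageI[OF b(1), of "(`) g"] by (simp add: Q_def)
    then show ?thesis using b(2) by (simp add: delete_vertex_def)
  qed
  moreover have "finite (edges Q)"
    using Q finite_subset[of "edges Q" "Pow (verts Q)"] by (auto simp: simple_graph_def)
  moreover have "verts (delete_vertex G u) = verts Q"
    by (simp add: Q_def delete_vertex_def)
  ultimately have "num_acyclic_orientations (delete_vertex G u) < num_acyclic_orientations Q"
    using num_acyclic_orientations_mono_strong[OF Gu Q]
      card_gt_0_iff[of "edges Q - edges (delete_vertex G u)"]
    by (metis add.commute empty_iff finite_Diff less_add_same_cancel2 order_less_le_trans)
  moreover have "card (incomparable_orientations G u w) \<le> num_acyclic_orientations (delete_vertex G u)"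
    using G ne(2) dom by (rule card_incomparable_dominated_le)
  moreover have "num_acyclic_orientations Q \<le> card (incomparable_orientations G u v)"
    using G Q ne g by (intro card_incomparable_ge_quotient[where g = g]) (auto simp: Q_def)
  ultimately show ?thesis
    using num_acyclic_orientations_add_edge[OF G V(1,2) ne(1) new(1)]
      num_acyclic_orientations_add_edge[OF G V(1,3) ne(2) new(2)]
    by linarith
qed

section \<open>Moving an edge of a complete bipartite graph\<close>

theorem theorem4p1:
  fixes n1 n2 :: nat
    and V1 V2 :: "'a set"
    and e e1 :: "'a set"
    and u w :: 'a
  assumes "n1 \<ge> 2" and "n2 \<ge> 2"
    and "finite V1" and "finite V2" and "V1 \<inter> V2 = {}"
    and "card V1 = n1" and "card V2 = n2"
    and "e \<in> edges (complete_bipartite V1 V2)"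
    and "u \<in> e" and "u \<in> V1"
    and "w \<in> V1" and "w \<noteq> u"
    and "e1 = {u, w}"
  shows "num_acyclic_orientations (complete_bipartite V1 V2)
       > num_acyclic_orientations (delete_edge (add_edge (complete_bipartite V1 V2) e1) e)"
proof -
  let ?K = "complete_bipartite V1 V2"
  let ?H = "delete_edge ?K e"
  obtain v where v: "v \<in> V2" "e = {u, v}"
    using assms by (auto simp: complete_bipartite_def)
  have uv: "u \<noteq> v" "v \<noteq> w" using v assms by auto
  have outside: "u \<notin> V2" "w \<notin> V2" "v \<notin> V1" using v assms by auto
  have edge: "{p, q} \<in> edges ?H \<longleftrightarrow>
      (p \<in> V1 \<and> q \<in> V2 \<or> p \<in> V2 \<and> q \<in> V1) \<and> {p, q} \<noteq> {u, v}" for p q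
    using v by (auto simp: complete_bipartite_def delete_edge_def doubleton_eq_iff)
  have sides: "p \<noteq> q" if "p \<in> V1" "q \<in> V2" for p q
    using that assms(5) by blast
  have H: "simple_graph ?H"
    using assms(3,4) sides
    by (auto simp: simple_graph_def delete_edge_def complete_bipartite_def)
  have verts: "verts ?H = V1 \<union> V2" by (simp add: delete_edge_def complete_bipartite_def)
  obtain b where b: "b \<in> V2" "b \<noteq> v"
    using \<open>n2 \<ge> 2\<close> \<open>card V2 = n2\<close> \<open>finite V2\<close> v(1)
    by (metis card_le_Suc0_iff_eq not_less_eq_eq numeral_2_eq_2)
  have "num_acyclic_orientations (add_edge ?H {u, w}) < num_acyclic_orientations (add_edge ?H {u, v})"
  proof (rule num_acyclic_orientations_add_dominated_less[OF H, where b = b])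
    show "u \<in> verts ?H" "v \<in> verts ?H" "w \<in> verts ?H"
      using verts v \<open>u \<in> V1\<close> \<open>w \<in> V1\<close> by auto
    show "{u, v} \<notin> edges ?H" "{u, w} \<notin> edges ?H" "{v, b} \<notin> edges ?H"
      using outside sides[OF _ b(1)] by (auto simp: edge)
    show "{u, b} \<in> edges ?H"
      using b uv \<open>u \<in> V1\<close> by (simp add: edge doubleton_eq_iff)
    show "{w, q} \<in> edges ?H" if "{u, q} \<in> edges ?H" for q
      using that uv outside \<open>w \<in> V1\<close> \<open>w \<noteq> u\<close> by (auto simp: edge doubleton_eq_iff)
  qed (use uv \<open>w \<noteq> u\<close> in auto)
  moreover have "add_edge ?H {u, v} = ?K"
    using v assms(8) by (simp add: add_edge_def delete_edge_def insert_absorb)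
  moreover have "add_edge ?H {u, w} = delete_edge (add_edge ?K e1) e"
  proof -
    have "e1 \<noteq> e" using v uv assms by (auto simp: doubleton_eq_iff)
    then show ?thesis
      unfolding \<open>e1 = {u, w}\<close> by (simp add: add_edge_def delete_edge_def insert_Diff_if)
  qed
  ultimately show ?thesis by simp
qed

end
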